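(* For every d-spectral space $(X,\tau_+,\tau_-)$: (i) the de Groot dual $(X,\tau_+^k,\tau_-^k)$ is d-spectral; (ii) the patch space $(X,\tau_+\vee\tau_-^k,\ \tau_-\vee\tau_+^k)$ is d-Boolean.
   Context: A bitopological space is a triple $(X,\tau_+,\tau_-)$ with $X$ a set and $\tau_+,\tau_-$ topologies on $X$. It is compact (resp. $T_0$) if $(X,\tau_+\vee\tau_-)$ is compact (resp. $T_0$), where $\vee$ denotes the join of topologies. It is zero-dimensional if $\tau_+$ has a basis of $\tau_-$-closed sets and $\tau_-$ has a basis of $\tau_+$-closed sets. A d-Boolean space is a compact, $T_0$, zero-dimensional bitopological space. An element $x$ of a poset is finite if for each directed subset $D$ having a join with $x\sqsubseteq\bigsqcup D$, one has $x\sqsubseteq d$ for some $d\in D$. A frame is coherent if every element is a join of finite elements, $1$ is finite, and the meet of two finite elements is finite. $(X,\tau_+,\tau_-)$ is d-sober if for every pair $(K_+,K_-)$, where $K_+$ is a (nonempty) irreducible closed set of $(X,\tau_+)$ and $K_-$ a (nonempty) irreducible closed set of $(X,\tau_-)$, such that for all $U\in\tau_+$, $V\in\tau_-$: (i) $U\cap V=\varnothing$ implies $K_+\cap U=\varnothing$ or $K_-\cap V=\varnothing$; (ii) $U\cup V=X$ implies $K_+\cap U\ne\varnothing$ or $K_-\cap V\neq\varnothing$; there is a unique $x\in X$ such that $K_+$ is the $\tau_+$-closure of $\{x\}$ and $K_-$ is the $\tau_-$-closure of $\{x\}$. $(X,\tau_+,\tau_-)$ is d-spectral if it is compact, d-sober,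 and both $\tau_+$ and $\tau_-$ are coherent frames. For a topological space $(X,\tau)$, a subset is saturated if it is an upper set for the specialization preorder ($x\le y$ iff $x\in\overline{\{y\}}$). The co-compact topology $\tau^k$ is the topology on $X$ having the compact saturated subsets of $(X,\tau)$ as a subbasis of closed sets. The de Groot dual of $(X,\tau_+,\tau_-)$ is $(X,\tau_+^k,\tau_-^k)$; its patch space is $(X,\tau_+\vee\tau_-^k,\ \tau_-\vee\tau_+^k)$. *)

theory Defs
  imports "HOL-Algebra.Complete_Lattice" "HOL-Analysis.Analysis"
begin

definition directed_in :: "('b, 'c) gorder_scheme \<Rightarrow> 'b set \<Rightarrow> bool" where
  "directed_in L D \<longleftrightarrow>
     D \<subseteq> carrier L \<and> D \<noteq> {} \<and>
     (\<forall>x\<in>D. \<forall>y\<in>D. \<exists>z\<in>D. x \<sqsubseteq>\<^bsub>L\<^esub> z \<and> y \<sqsubseteq>\<^bsub>L\<^esub> z)"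

definition finite_element :: "('b, 'c) gorder_scheme \<Rightarrow> 'b \<Rightarrow> bool" where
  "finite_element L x \<longleftrightarrow>
     x \<in> carrier L \<and>
     (\<forall>D s. directed_in L D \<longrightarrow> is_lub L s D \<longrightarrow> x \<sqsubseteq>\<^bsub>L\<^esub> s \<longrightarrow> (\<exists>d\<in>D. x \<sqsubseteq>\<^bsub>L\<^esub> d))"

definition frame :: "('b, 'c) gorder_scheme \<Rightarrow> bool" where
  "frame L \<longleftrightarrow>
     complete_lattice L \<and>
     (\<forall>a\<in>carrier L. \<forall>S. S \<subseteq> carrier L \<longrightarrow>
        a \<sqinter>\<^bsub>L\<^esub> (\<Squnion>\<^bsub>L\<^esub> S) = \<Squnion>\<^bsub>L\<^esub> ((\<lambda>b. a \<sqinter>\<^bsub>L\<^esub> b) ` S))"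

definition coherent_frame :: "('b, 'c) gorder_scheme \<Rightarrow> bool" where
  "coherent_frame L \<longleftrightarrow>
     frame L \<and>
     (\<forall>x\<in>carrier L. \<exists>S. (\<forall>y\<in>S. finite_element L y) \<and> is_lub L x S) \<and>
     finite_element L \<top>\<^bsub>L\<^esub> \<and>
     (\<forall>x y. finite_element L x \<longrightarrow> finite_element L y \<longrightarrow> finite_element L (x \<sqinter>\<^bsub>L\<^esub> y))"

definition opens_order :: "'a topology \<Rightarrow> 'a set gorder" where
  "opens_order T = \<lparr>carrier = {U. openin T U}, eq = (=), le = (\<subseteq>)\<rparr>"

definition topology_join :: "'a topology \<Rightarrow> 'a topology \<Rightarrow> 'a topology" where
  "topology_join S T = topology_generated_by ({U. openin S U} \<union> {U. openin T U})"

definition irreducible_closed_in :: "'a topology \<Rightarrow> 'a set \<Rightarrow> bool" where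
  "irreducible_closed_in T K \<longleftrightarrow>
     closedin T K \<and> K \<noteq> {} \<and>
     (\<forall>A B. closedin T A \<longrightarrow> closedin T B \<longrightarrow> K = A \<union> B \<longrightarrow> K = A \<or> K = B)"

definition specialization_le :: "'a topology \<Rightarrow> 'a \<Rightarrow> 'a \<Rightarrow> bool" where
  "specialization_le T x y \<longleftrightarrow> x \<in> T closure_of {y}"

definition saturated_in :: "'a topology \<Rightarrow> 'a set \<Rightarrow> bool" where
  "saturated_in T A \<longleftrightarrow>
     A \<subseteq> topspace T \<and>
     (\<forall>x\<in>A. \<forall>y\<in>topspace T. specialization_le T x y \<longrightarrow> y \<in> A)"

text \<open>The empty set is compact and saturated, so the underlying set of the co-compact
  topology is again \<^term>\<open>topspace T\<close>.\<close>

definition cocompact_topology :: "'a topology \<Rightarrow> 'a topology" where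
  "cocompact_topology T =
     topology_generated_by {topspace T - K |K. compactin T K \<and> saturated_in T K}"

lemma topspace_cocompact_topology [simp]: "topspace (cocompact_topology T) = topspace T"
  by (auto simp: cocompact_topology_def saturated_in_def intro!: exI[of _ "{}"])

text \<open>A bitopological space is a pair of topologies with the same underlying set; compactness
  and \<open>T\<^sub>0\<close> refer to the join of the two topologies.\<close>

definition bitop_space :: "'a topology \<Rightarrow> 'a topology \<Rightarrow> bool" where
  "bitop_space Tp Tm \<longleftrightarrow> topspace Tp = topspace Tm"

lemma topspace_topology_join:
  "bitop_space Tp Tm \<Longrightarrow> topspace (topology_join Tp Tm) = topspace Tp"
  by (auto simp: bitop_space_def topology_join_def dest: openin_subset)

definition bitop_compact :: "'a topology \<Rightarrow> 'a topology \<Rightarrow> bool" where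
  "bitop_compact Tp Tm \<longleftrightarrow> compact_space (topology_join Tp Tm)"

definition bitop_t0 :: "'a topology \<Rightarrow> 'a topology \<Rightarrow> bool" where
  "bitop_t0 Tp Tm \<longleftrightarrow> t0_space (topology_join Tp Tm)"

definition bitop_zero_dimensional :: "'a topology \<Rightarrow> 'a topology \<Rightarrow> bool" where
  "bitop_zero_dimensional Tp Tm \<longleftrightarrow>
     (\<exists>P. openin Tp = arbitrary union_of P \<and> (\<forall>B. P B \<longrightarrow> closedin Tm B)) \<and>
     (\<exists>P. openin Tm = arbitrary union_of P \<and> (\<forall>B. P B \<longrightarrow> closedin Tp B))"

definition d_Boolean :: "'a topology \<Rightarrow> 'a topology \<Rightarrow> bool" where
  "d_Boolean Tp Tm \<longleftrightarrow>
     bitop_space Tp Tm \<and> bitop_compact Tp Tm \<and> bitop_t0 Tp Tm \<and> bitop_zero_dimensional Tp Tm"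

definition d_sober :: "'a topology \<Rightarrow> 'a topology \<Rightarrow> bool" where
  "d_sober Tp Tm \<longleftrightarrow>
     (\<forall>Kp Km.
        irreducible_closed_in Tp Kp \<longrightarrow> irreducible_closed_in Tm Km \<longrightarrow>
        (\<forall>U V. openin Tp U \<longrightarrow> openin Tm V \<longrightarrow>
           (U \<inter> V = {} \<longrightarrow> Kp \<inter> U = {} \<or> Km \<inter> V = {}) \<and>
           (U \<union> V = topspace Tp \<longrightarrow> Kp \<inter> U \<noteq> {} \<or> Km \<inter> V \<noteq> {})) \<longrightarrow>
        (\<exists>!x. x \<in> topspace Tp \<and> Kp = Tp closure_of {x} \<and> Km = Tm closure_of {x}))"

definition d_spectral :: "'a topology \<Rightarrow> 'a topology \<Rightarrow> bool" where
  "d_spectral Tp Tm \<longleftrightarrow>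
     bitop_space Tp Tm \<and> bitop_compact Tp Tm \<and> d_sober Tp Tm \<and>
     coherent_frame (opens_order Tp) \<and> coherent_frame (opens_order Tm)"

end

theory Submission
  imports Defs
begin

text \<open>The compact open sets of \<open>\<tau>\<^sub>+\<close> and of \<open>\<tau>\<^sub>-\<close> form bases that are bounded distributive
  lattices. By compactness and d-sobriety, a pair of prime filters, one in each lattice, comes from
  a point of \<open>X\<close> as soon as members of the two filters always meet and non-members never cover
  \<open>X\<close> (the filters correspond to the irreducible closed sets of d-sobriety).

  The traces of an ultrafilter on \<open>X\<close> on both lattices are such a pair, and the resulting point is
  a limit for the topology generated by all four topologies involved; hence that topology is
  compact. The complements of the compact open sets of \<open>\<tau>\<close> form a basis of \<open>\<tau>\<^sup>k\<close>, and by the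
  compactness just mentioned they are exactly the compact open sets of \<open>\<tau>\<^sup>k\<close>. This gives
  coherence of the dual and clopen bases of the patch space. For d-sobriety of the dual, an
  irreducible closed set \<open>K\<close> of \<open>\<tau>\<^sup>k\<close> yields the prime filter of all compact open sets of \<open>\<tau>\<close>
  containing \<open>K\<close>; passing to complements exchanges the conditions (i) and (ii).\<close>

section \<open>Ultrafilters and compactness\<close>

text \<open>Upward closure is not listed as a clause; it is derived from the others in
  \<open>ultrafilter_on_upward\<close>.\<close>

definition ultrafilter_on :: "'a set \<Rightarrow> 'a set set \<Rightarrow> bool" where
  "ultrafilter_on X M \<longleftrightarrow>
     M \<subseteq> Pow X \<and> {} \<notin> M \<and> X \<in> M \<and>
     (\<forall>A\<in>M. \<forall>B\<in>M. A \<inter> B \<in> M) \<and> (\<forall>A. A \<subseteq> X \<longrightarrow> A \<in> M \<or> X - A \<in> M)"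

lemma ultrafilter_on_Diff:
  assumes "ultrafilter_on X M" "A \<subseteq> X" "A \<notin> M"
  shows "X - A \<in> M"
  using assms unfolding ultrafilter_on_def by blast

lemma ultrafilter_on_upward:
  assumes "ultrafilter_on X M" "A \<in> M" "A \<subseteq> B" "B \<subseteq> X"
  shows "B \<in> M"
proof (rule ccontr)
  assume "B \<notin> M"
  then have "X - B \<in> M"
    using ultrafilter_on_Diff assms(1,4) by blast
  then have "A \<inter> (X - B) \<in> M"
    using assms(1,2) unfolding ultrafilter_on_def by blast
  moreover have "A \<inter> (X - B) = {}"
    using assms by blast
  ultimately show False
    using assms by (simp add: ultrafilter_on_def)
qed

lemma ultrafilter_on_disjoint:
  assumes "ultrafilter_on X M" "A \<in> M" "B \<in> M"
  shows "A \<inter> B \<noteq> {}"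
  using assms unfolding ultrafilter_on_def by metis

lemma ultrafilter_on_Un:
  assumes "ultrafilter_on X M" "A \<union> B \<in> M" "A \<subseteq> X" "B \<subseteq> X"
  shows "A \<in> M \<or> B \<in> M"
proof (rule ccontr)
  assume "\<not> (A \<in> M \<or> B \<in> M)"
  then have "X - A \<in> M" "X - B \<in> M"
    using ultrafilter_on_Diff[OF assms(1)] assms(3,4) by blast+
  then have "(X - A) \<inter> (X - B) \<in> M"
    using assms(1) unfolding ultrafilter_on_def by blast
  then show False
    using ultrafilter_on_disjoint[OF assms(1,2)] by blast
qed

text \<open>Zorn's lemma gives a maximal family with the finite intersection property that contains
  \<open>F\<close>. Taking intersections with \<open>X\<close> makes the empty subfamily demand that
  \<open>X\<close> be nonempty.\<close>

lemma ultrafilter_on_exists: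
  assumes "F \<subseteq> Pow X" and fip: "\<And>G. finite G \<Longrightarrow> G \<subseteq> F \<Longrightarrow> X \<inter> \<Inter>G \<noteq> {}"
  obtains M where "ultrafilter_on X M" "F \<subseteq> M"
proof -
  define S where "S = {C. F \<subseteq> C \<and> C \<subseteq> Pow X \<and> (\<forall>G. finite G \<longrightarrow> G \<subseteq> C \<longrightarrow> X \<inter> \<Inter>G \<noteq> {})}"
  have "\<exists>M\<in>S. \<forall>C\<in>S. M \<subseteq> C \<longrightarrow> C = M"
  proof (rule subset_Zorn_nonempty)
    have "F \<in> S"
      unfolding S_def using assms by simp
    then show "S \<noteq> {}"
      by blast
    fix \<C> assume \<C>: "\<C> \<noteq> {}" "subset.chain S \<C>"
    then have sub: "\<C> \<subseteq> S"
      by (simp add: subset_chain_def)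
    have "X \<inter> \<Inter>G \<noteq> {}" if G: "finite G" "G \<subseteq> \<Union>\<C>" for G
    proof -
      obtain B where "B \<in> \<C>" "G \<subseteq> B"
        using finite_subset_Union_chain[OF G \<C>] .
      then have "B \<in> S"
        using sub by blast
      then show ?thesis
        using \<open>finite G\<close> \<open>G \<subseteq> B\<close> by (simp add: S_def)
    qed
    moreover have "F \<subseteq> C" "C \<subseteq> Pow X" if "C \<in> \<C>" for C
      using that sub by (auto simp: S_def)
    then have "F \<subseteq> \<Union>\<C>" "\<Union>\<C> \<subseteq> Pow X"
      using \<C>(1) by blast+
    ultimately show "\<Union>\<C> \<in> S"
      by (simp add: S_def)
  qed
  then obtain M where M: "M \<in> S" and max: "\<And>C. C \<in> S \<Longrightarrow> M \<subseteq> C \<Longrightarrow> C = M"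
    by blast
  have FM: "F \<subseteq> M" and MX: "M \<subseteq> Pow X"
    and Mfip: "\<And>G. finite G \<Longrightarrow> G \<subseteq> M \<Longrightarrow> X \<inter> \<Inter>G \<noteq> {}"
    using M by (simp_all add: S_def)
  \<comment> \<open>By maximality, adding \<open>A\<close> destroys the finite intersection
    property, so finitely many members of \<open>M\<close> already intersect inside the complement
    of \<open>A\<close>.\<close>
  have blocked: "\<exists>G. finite G \<and> G \<subseteq> M \<and> A \<inter> \<Inter>G = {}" if A: "A \<subseteq> X" "A \<notin> M" for A
  proof -
    have "insert A M \<notin> S"
      using max[of "insert A M"] A by blast
    moreover have "F \<subseteq> insert A M" "insert A M \<subseteq> Pow X"
      using FM MX A by blast+
    ultimately obtain G where G: "finite G" "G \<subseteq> insert A M" "X \<inter> \<Inter>G = {}"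
      unfolding S_def by blast
    have "A \<inter> \<Inter>(G - {A}) = {}"
      using G(3) A(1) by blast
    then show ?thesis
      using G by (intro exI[of _ "G - {A}"]) auto
  qed
  \<comment> \<open>If both \<open>A\<close> and its complement were blocked, the union of the two
    finite witnesses would be a finite part of \<open>M\<close> whose intersection misses
    \<open>X\<close>.\<close>
  have ult: "A \<in> M \<or> X - A \<in> M" if A: "A \<subseteq> X" for A
  proof (rule ccontr)
    assume "\<not> ?thesis"
    then obtain G H where "finite G" "G \<subseteq> M" "A \<inter> \<Inter>G = {}"
      and "finite H" "H \<subseteq> M" "(X - A) \<inter> \<Inter>H = {}"
      using blocked[of A] blocked[of "X - A"] A by blast
    moreover have "X \<inter> \<Inter>(G \<union> H) \<subseteq> A \<inter> \<Inter>G \<union> (X - A) \<inter> \<Inter>H"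
      by blast
    ultimately show False
      using Mfip[of "G \<union> H"] by auto
  qed
  have empty: "{} \<notin> M"
    using Mfip[of "{{}}"] by auto
  have "A \<inter> B \<in> M" if AB: "A \<in> M" "B \<in> M" for A B
  proof (rule ccontr)
    assume "A \<inter> B \<notin> M"
    then have "X - (A \<inter> B) \<in> M"
      using ult[of "A \<inter> B"] AB MX by blast
    then show False
      using Mfip[of "{A, B, X - (A \<inter> B)}"] AB by auto
  qed
  then have "ultrafilter_on X M"
    using MX empty ult ult[of X] by (auto simp: ultrafilter_on_def)
  then show ?thesis
    using FM that by blast
qed

text \<open>If an open cover has no finite subcover, the complements of its members have the finite
  intersection property and extend to an ultrafilter. A cover member containing a limit point then
  lies in the ultrafilter together with its complement.\<close>

lemma compact_space_ultrafilterI: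
  assumes lim: "\<And>M. ultrafilter_on (topspace T) M \<Longrightarrow>
                  \<exists>x\<in>topspace T. \<forall>U. openin T U \<longrightarrow> x \<in> U \<longrightarrow> U \<in> M"
  shows "compact_space T"
  unfolding compact_space_alt
proof (intro allI impI, elim conjE, rule ccontr)
  fix \<U> assume op: "\<forall>U\<in>\<U>. openin T U" and cov: "topspace T \<subseteq> \<Union>\<U>"
    and no: "\<not> (\<exists>\<F>. finite \<F> \<and> \<F> \<subseteq> \<U> \<and> topspace T \<subseteq> \<Union>\<F>)"
  define F where "F = (\<lambda>U. topspace T - U) ` \<U>"
  obtain M where M: "ultrafilter_on (topspace T) M" "F \<subseteq> M"
  proof (rule ultrafilter_on_exists)
    show "F \<subseteq> Pow (topspace T)"
      by (auto simp: F_def)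
    fix G assume "finite G" "G \<subseteq> F"
    then obtain \<F> where \<F>: "\<F> \<subseteq> \<U>" "finite \<F>" "G = (\<lambda>U. topspace T - U) ` \<F>"
      unfolding F_def by (metis finite_subset_image)
    then have "\<not> topspace T \<subseteq> \<Union>\<F>"
      using no by blast
    then show "topspace T \<inter> \<Inter>G \<noteq> {}"
      unfolding \<F>(3) by blast
  qed
  obtain x where x: "x \<in> topspace T" "\<And>U. openin T U \<Longrightarrow> x \<in> U \<Longrightarrow> U \<in> M"
    using lim[OF M(1)] by blast
  then obtain U where U: "U \<in> \<U>" "x \<in> U"
    using cov by blast
  have "topspace T - U \<in> M"
    using U(1) M(2) by (auto simp: F_def)
  moreover have "U \<in> M"
    using x(2) op U by blast
  ultimately show False
    using ultrafilter_on_disjoint[OF M(1)] by blast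
qed

section \<open>Generated topologies\<close>

lemma openin_topology_join:
  "openin S U \<Longrightarrow> openin (topology_join S T) U"
  "openin T U \<Longrightarrow> openin (topology_join S T) U"
  by (auto simp: topology_join_def intro: topology_generated_by_Basis)

lemma openin_topology_join_least:
  assumes "openin (topology_join S T) U"
    and "\<And>V. openin S V \<Longrightarrow> openin J V" "\<And>V. openin T V \<Longrightarrow> openin J V"
  shows "openin J U"
proof (rule generate_topology_on_coarsest[of "openin J"])
  show "generate_topology_on ({U. openin S U} \<union> {U. openin T U}) U"
    using assms(1) unfolding topology_join_def by (rule openin_topology_generated_by)
qed (use assms(2,3) in auto)

text \<open>Convergence of an ultrafilter can be tested on a subbasis: intersections stay in
  \<open>M\<close> because it is a filter, unions because it is upward closed.\<close>

lemma ultrafilter_on_generated: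
  assumes "ultrafilter_on X M" and gen: "openin (topology_generated_by \<S>) U" "x \<in> U"
    and "\<Union>\<S> \<subseteq> X" and sub: "\<And>S. S \<in> \<S> \<Longrightarrow> x \<in> S \<Longrightarrow> S \<in> M"
  shows "U \<in> M"
proof -
  have "generate_topology_on \<S> U"
    using gen(1) by (rule openin_topology_generated_by)
  \<comment> \<open>The inclusion in \<open>X\<close> is carried through the induction because
    \<open>ultrafilter_on_upward\<close> asks for it in the union case.\<close>
  then have "U \<subseteq> X \<and> (x \<in> U \<longrightarrow> U \<in> M)"
  proof induction
    case (Int a b)
    then show ?case
      using assms(1) by (auto simp: ultrafilter_on_def)
  next
    case (UN K)
    then have "\<Union>K \<subseteq> X"
      by blast
    moreover have "\<Union>K \<in> M" if x: "x \<in> \<Union>K"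
    proof -
      obtain k where "k \<in> K" "x \<in> k"
        using x by blast
      then show ?thesis
        using UN.IH ultrafilter_on_upward[OF assms(1), of k "\<Union>K"] \<open>\<Union>K \<subseteq> X\<close> by blast
    qed
    ultimately show ?case
      by blast
  next
    case (Basis s)
    then show ?case
      using assms(4) sub by blast
  qed simp
  then show ?thesis
    using gen(2) by blast
qed

lemma ultrafilter_on_join:
  assumes "ultrafilter_on X M" "topspace S \<subseteq> X" "topspace T \<subseteq> X"
    and "\<And>U. openin S U \<Longrightarrow> x \<in> U \<Longrightarrow> U \<in> M" "\<And>U. openin T U \<Longrightarrow> x \<in> U \<Longrightarrow> U \<in> M"
    and "openin (topology_join S T) U" "x \<in> U"
  shows "U \<in> M"
  using assms(6,7) unfolding topology_join_def
proof (rule ultrafilter_on_generated[OF assms(1)])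
  show "\<Union>({U. openin S U} \<union> {U. openin T U}) \<subseteq> X"
    using assms(2,3) openin_subset by blast
  show "V \<in> M" if "V \<in> {U. openin S U} \<union> {U. openin T U}" "x \<in> V" for V
    using that assms(4)[of V] assms(5)[of V] by auto
qed

lemma compactin_coarser:
  assumes "compactin S C" "topspace S = topspace T" "\<And>U. openin T U \<Longrightarrow> openin S U"
  shows "compactin T C"
  unfolding compactin_def
proof (intro conjI allI impI)
  show "C \<subseteq> topspace T"
    using compactin_subset_topspace[OF assms(1)] assms(2) by simp
  show "\<exists>\<F>. finite \<F> \<and> \<F> \<subseteq> \<U> \<and> C \<subseteq> \<Union>\<F>" if "(\<forall>U\<in>\<U>. openin T U) \<and> C \<subseteq> \<Union>\<U>" for \<U>
    by (rule compactinD[OF assms(1)]) (use that assms(3) in auto)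
qed

text \<open>Reduces zero-dimensionality to a subbasis: sets that are open in the generated topology
  and closed in \<open>T\<close> are stable under binary intersection, and a union inherits the
  neighbourhoods found in its members.\<close>

lemma generated_clopen_basis:
  assumes "openin (topology_generated_by \<S>) U" "x \<in> U"
    and sub: "\<And>S y. S \<in> \<S> \<Longrightarrow> y \<in> S \<Longrightarrow>
       \<exists>B. openin (topology_generated_by \<S>) B \<and> closedin T B \<and> y \<in> B \<and> B \<subseteq> S"
  shows "\<exists>B. openin (topology_generated_by \<S>) B \<and> closedin T B \<and> x \<in> B \<and> B \<subseteq> U"
proof -
  have "generate_topology_on \<S> U"
    using assms(1) by (rule openin_topology_generated_by)
  then have "\<forall>y\<in>U. \<exists>B. openin (topology_generated_by \<S>) B \<and> closedin T B \<and> y \<in> B \<and> B \<subseteq> U"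
  proof induction
    case (Int a b)
    show ?case
    proof
      fix y assume y: "y \<in> a \<inter> b"
      obtain B where B: "openin (topology_generated_by \<S>) B" "closedin T B" "y \<in> B" "B \<subseteq> a"
        using bspec[OF Int.IH(1) IntD1[OF y]] by blast
      obtain C where C: "openin (topology_generated_by \<S>) C" "closedin T C" "y \<in> C" "C \<subseteq> b"
        using bspec[OF Int.IH(2) IntD2[OF y]] by blast
      show "\<exists>B. openin (topology_generated_by \<S>) B \<and> closedin T B \<and> y \<in> B \<and> B \<subseteq> a \<inter> b"
        using B(4) C(4)
        by (intro exI[of _ "B \<inter> C"] conjI openin_Int closedin_Int IntI Int_mono B C)
    qed
  next
    case (UN K)
    show ?case
    proof
      fix y assume "y \<in> \<Union>K"
      then obtain k where k: "k \<in> K" "y \<in> k"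
        by blast
      then obtain B where "openin (topology_generated_by \<S>) B" "closedin T B" "y \<in> B" "B \<subseteq> k"
        using UN.IH by blast
      then show "\<exists>B. openin (topology_generated_by \<S>) B \<and> closedin T B \<and> y \<in> B \<and> B \<subseteq> \<Union>K"
        using k(1) by blast
    qed
  next
    case (Basis s)
    then show ?case
      using sub by blast
  qed simp
  then show ?thesis
    using assms(2) by blast
qed

section \<open>Coherence of the frame of open sets\<close>

definition compact_open :: "'a topology \<Rightarrow> 'a set \<Rightarrow> bool" where
  "compact_open T B \<longleftrightarrow> openin T B \<and> compactin T B"

text \<open>The point-set form of coherence of the frame of open sets;
  \<open>coherent_frame_opens_order\<close> proves the equivalence.\<close>

definition coherent_space :: "'a topology \<Rightarrow> bool" where
  "coherent_space T \<longleftrightarrow>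
     compact_space T \<and>
     (\<forall>U x. openin T U \<longrightarrow> x \<in> U \<longrightarrow> (\<exists>B. compact_open T B \<and> x \<in> B \<and> B \<subseteq> U)) \<and>
     (\<forall>A B. compact_open T A \<longrightarrow> compact_open T B \<longrightarrow> compact_open T (A \<inter> B))"

section \<open>Lattice operations and finite elements in the frame of open sets\<close>

lemma opens_order_simps [simp]:
  "carrier (opens_order T) = {U. openin T U}"
  "le (opens_order T) = (\<subseteq>)"
  "eq (opens_order T) = (=)"
  by (simp_all add: opens_order_def)

lemma is_lub_opens_order_iff:
  assumes "S \<subseteq> {U. openin T U}"
  shows "is_lub (opens_order T) s S \<longleftrightarrow>
    openin T s \<and> (\<forall>A\<in>S. A \<subseteq> s) \<and> (\<forall>U. openin T U \<longrightarrow> (\<forall>A\<in>S. A \<subseteq> U) \<longrightarrow> s \<subseteq> U)"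
proof -
  have "Upper (opens_order T) S = {U. openin T U \<and> (\<forall>A\<in>S. A \<subseteq> U)}"
    using assms by (auto simp: Upper_def)
  then show ?thesis
    by (auto simp: least_def)
qed

lemma is_glb_opens_order_iff:
  assumes "S \<subseteq> {U. openin T U}"
  shows "is_glb (opens_order T) i S \<longleftrightarrow>
    openin T i \<and> (\<forall>A\<in>S. i \<subseteq> A) \<and> (\<forall>U. openin T U \<longrightarrow> (\<forall>A\<in>S. U \<subseteq> A) \<longrightarrow> U \<subseteq> i)"
proof -
  have "Lower (opens_order T) S = {U. openin T U \<and> (\<forall>A\<in>S. U \<subseteq> A)}"
    using assms by (auto simp: Lower_def)
  then show ?thesis
    by (auto simp: greatest_def)
qed

lemma is_lub_opens_order:
  assumes "S \<subseteq> {U. openin T U}"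
  shows "is_lub (opens_order T) s S \<longleftrightarrow> s = \<Union>S"
proof -
  have "openin T (\<Union>S)"
    using assms by (intro openin_Union) blast
  then show ?thesis
    unfolding is_lub_opens_order_iff[OF assms]
    by (metis Sup_least Sup_upper subset_antisym)
qed

lemma partial_order_opens_order: "partial_order (opens_order T)"
  by unfold_locales auto

lemma sup_opens_order:
  assumes "S \<subseteq> {U. openin T U}"
  shows "\<Squnion>\<^bsub>opens_order T\<^esub> S = \<Union>S"
  unfolding sup_def is_lub_opens_order[OF assms] by simp

text \<open>The witness is the interior of the intersection, written as the union of all open lower
  bounds. For empty \<open>S\<close> this gives the whole space, whereas a plain intersection would
  give \<open>UNIV\<close>.\<close>

lemma is_glb_opens_order:
  assumes "S \<subseteq> {U. openin T U}"
  shows "is_glb (opens_order T) (\<Union>{U. openin T U \<and> (\<forall>A\<in>S. U \<subseteq> A)}) S"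
proof -
  have "openin T (\<Union>{U. openin T U \<and> (\<forall>A\<in>S. U \<subseteq> A)})"
    by (intro openin_Union) simp
  then show ?thesis
    unfolding is_glb_opens_order_iff[OF assms] by blast
qed

lemma meet_opens_order:
  assumes "openin T A" "openin T B"
  shows "A \<sqinter>\<^bsub>opens_order T\<^esub> B = A \<inter> B"
proof -
  have "is_glb (opens_order T) C {A, B} \<longleftrightarrow> C = A \<inter> B" for C
  proof -
    have "is_glb (opens_order T) C {A, B} \<longleftrightarrow>
        openin T C \<and> C \<subseteq> A \<inter> B \<and> (\<forall>U. openin T U \<longrightarrow> U \<subseteq> A \<inter> B \<longrightarrow> U \<subseteq> C)"
      using assms by (subst is_glb_opens_order_iff) auto
    then show ?thesis
      using openin_Int[OF assms] by (metis order_refl subset_antisym)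
  qed
  then show ?thesis
    by (simp add: meet_def inf_def)
qed

lemma top_opens_order: "\<top>\<^bsub>opens_order T\<^esub> = topspace T"
  unfolding top_def
proof (rule some_equality)
  show "greatest (opens_order T) (topspace T) (carrier (opens_order T))"
    by (auto simp: greatest_def dest: openin_subset)
  show "C = topspace T" if "greatest (opens_order T) C (carrier (opens_order T))" for C
    using that by (auto simp: greatest_def dest: openin_subset)
qed

lemma frame_opens_order: "frame (opens_order T)"
  unfolding frame_def
proof (intro conjI ballI allI impI)
  show "complete_lattice (opens_order T)"
  proof (rule partial_order.complete_latticeI[OF partial_order_opens_order])
    fix S assume "S \<subseteq> carrier (opens_order T)"
    then have S: "S \<subseteq> {U. openin T U}"
      by simp
    show "\<exists>s. is_lub (opens_order T) s S"
      using is_lub_opens_order[OF S] by blast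
    show "\<exists>i. is_glb (opens_order T) i S"
      using is_glb_opens_order[OF S] by blast
  qed
  fix A S assume "A \<in> carrier (opens_order T)" "S \<subseteq> carrier (opens_order T)"
  then have A: "openin T A" and S: "S \<subseteq> {U. openin T U}"
    by auto
  have *: "(\<lambda>B. A \<sqinter>\<^bsub>opens_order T\<^esub> B) ` S = (\<lambda>B. A \<inter> B) ` S"
    using A S by (intro image_cong) (auto simp: meet_opens_order)
  have "openin T (\<Union>S)"
    using S by (intro openin_Union) blast
  then have "A \<sqinter>\<^bsub>opens_order T\<^esub> (\<Squnion>\<^bsub>opens_order T\<^esub> S) = A \<inter> \<Union>S"
    unfolding sup_opens_order[OF S] by (rule meet_opens_order[OF A])
  also have "\<dots> = \<Union>((\<lambda>B. A \<inter> B) ` S)"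
    by (rule Int_Union)
  also have "\<dots> = \<Squnion>\<^bsub>opens_order T\<^esub> ((\<lambda>B. A \<inter> B) ` S)"
    by (rule sup_opens_order[symmetric]) (use A S in auto)
  finally show "A \<sqinter>\<^bsub>opens_order T\<^esub> (\<Squnion>\<^bsub>opens_order T\<^esub> S) =
      \<Squnion>\<^bsub>opens_order T\<^esub> ((\<lambda>B. A \<sqinter>\<^bsub>opens_order T\<^esub> B) ` S)"
    unfolding * .
qed

lemma directed_in_opens_order:
  "directed_in (opens_order T) D \<longleftrightarrow>
     (\<forall>U\<in>D. openin T U) \<and> D \<noteq> {} \<and> (\<forall>A\<in>D. \<forall>B\<in>D. \<exists>C\<in>D. A \<subseteq> C \<and> B \<subseteq> C)"
  by (simp only: directed_in_def opens_order_simps subset_iff Ball_def mem_Collect_eq)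

lemma directed_Union_finite:
  assumes "directed_in (opens_order T) D" "finite F" "F \<subseteq> D"
  shows "\<exists>d\<in>D. \<Union>F \<subseteq> d"
  using assms(2,3)
proof (induction F)
  case empty
  have "D \<noteq> {}"
    using assms(1) by (simp add: directed_in_opens_order)
  then show ?case
    by auto
next
  case (insert A F)
  then obtain d where d: "d \<in> D" "\<Union>F \<subseteq> d"
    by auto
  have "A \<in> D" "\<forall>A\<in>D. \<forall>B\<in>D. \<exists>C\<in>D. A \<subseteq> C \<and> B \<subseteq> C"
    using insert.prems assms(1) by (simp_all add: directed_in_opens_order)
  then obtain e where "e \<in> D" "A \<subseteq> e" "d \<subseteq> e"
    using d(1) by metis
  then show ?case
    using d(2) by (intro bexI[of _ e]) auto
qed

lemma finite_element_opens_order_iff: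
  "finite_element (opens_order T) B \<longleftrightarrow>
     openin T B \<and> (\<forall>D. directed_in (opens_order T) D \<longrightarrow> B \<subseteq> \<Union>D \<longrightarrow> (\<exists>d\<in>D. B \<subseteq> d))"
proof -
  have "is_lub (opens_order T) s D \<longleftrightarrow> s = \<Union>D" if "directed_in (opens_order T) D" for s D
    using that by (intro is_lub_opens_order) (auto simp: directed_in_opens_order)
  then show ?thesis
    unfolding finite_element_def by auto
qed

text \<open>A directed family is an open cover in which a finite subcover can be replaced by a
  single member. Conversely, the finite unions of members of an open cover form a directed family
  with the same union.\<close>

lemma finite_element_opens_order: "finite_element (opens_order T) B \<longleftrightarrow> compact_open T B"
proof
  assume B: "compact_open T B"
  have "\<exists>d\<in>D. B \<subseteq> d" if D: "directed_in (opens_order T) D" "B \<subseteq> \<Union>D" for D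
  proof -
    have "compactin T B" "\<And>U. U \<in> D \<Longrightarrow> openin T U"
      using B D(1) by (simp_all add: compact_open_def directed_in_opens_order)
    then obtain F where F: "finite F" "F \<subseteq> D" "B \<subseteq> \<Union>F"
      using compactinD[of T B D] D(2) by metis
    then obtain d where "d \<in> D" "\<Union>F \<subseteq> d"
      using directed_Union_finite[OF D(1)] by metis
    then show ?thesis
      using F(3) by (intro bexI[of _ d]) auto
  qed
  then show "finite_element (opens_order T) B"
    using B by (simp add: finite_element_opens_order_iff compact_open_def)
next
  assume fin: "finite_element (opens_order T) B"
  then have B: "openin T B"
    by (simp add: finite_element_opens_order_iff)
  have "compactin T B"
    unfolding compactin_def
  proof (intro conjI allI impI)
    fix \<U> assume "(\<forall>U\<in>\<U>. openin T U) \<and> B \<subseteq> \<Union>\<U>"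
    then have op: "\<forall>U\<in>\<U>. openin T U" and cov: "B \<subseteq> \<Union>\<U>"
      by auto
    \<comment> \<open>The choice \<open>F = {}\<close> puts \<open>{}\<close> into \<open>D\<close>,
      so \<open>D\<close> is nonempty even when the cover is empty.\<close>
    define D where "D = {\<Union>F |F. finite F \<and> F \<subseteq> \<U>}"
    have D: "D \<subseteq> {U. openin T U}"
      using op by (auto simp: D_def)
    have "A \<union> C \<in> D" if AC: "A \<in> D" "C \<in> D" for A C
    proof -
      obtain F G where "A = \<Union>F" "finite F" "F \<subseteq> \<U>" "C = \<Union>G" "finite G" "G \<subseteq> \<U>"
        using AC unfolding D_def by blast
      then show ?thesis
        unfolding D_def by (intro CollectI exI[of _ "F \<union> G"]) auto
    qed
    moreover have "{} \<in> D"
      unfolding D_def by (intro CollectI exI[of _ "{}"]) simp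
    ultimately have "directed_in (opens_order T) D"
      using D unfolding directed_in_opens_order by (metis Un_upper1 Un_upper2 empty_iff mem_Collect_eq subsetD)
    moreover have "\<U> \<subseteq> D"
    proof
      fix U assume "U \<in> \<U>"
      then show "U \<in> D"
        unfolding D_def by (intro CollectI exI[of _ "{U}"]) auto
    qed
    then have "B \<subseteq> \<Union>D"
      using cov by blast
    ultimately obtain d where "d \<in> D" "B \<subseteq> d"
      using fin unfolding finite_element_opens_order_iff by metis
    then show "\<exists>\<F>. finite \<F> \<and> \<F> \<subseteq> \<U> \<and> B \<subseteq> \<Union>\<F>"
      by (auto simp: D_def)
  qed (use B openin_subset in blast)
  then show "compact_open T B"
    using B by (simp add: compact_open_def)
qed

text \<open>Joins are unions and finite elements are compact open sets, so being a join of finite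
  elements means being covered from inside by compact open sets.\<close>

lemma is_lub_finite_elements_iff:
  assumes "openin T U"
  shows "(\<exists>S. (\<forall>B\<in>S. finite_element (opens_order T) B) \<and> is_lub (opens_order T) U S) \<longleftrightarrow>
     (\<forall>x\<in>U. \<exists>B. compact_open T B \<and> x \<in> B \<and> B \<subseteq> U)" (is "?lub \<longleftrightarrow> ?basis")
proof
  assume ?lub
  then obtain S where S: "\<forall>B\<in>S. compact_open T B" and lub: "is_lub (opens_order T) U S"
    unfolding finite_element_opens_order by metis
  have "S \<subseteq> {U. openin T U}"
    using S by (auto simp: compact_open_def)
  then have "U = \<Union>S"
    using lub by (simp only: is_lub_opens_order)
  then show ?basis
    using S by (metis Union_iff Union_upper)
next
  assume basis: ?basis
  define S where "S = {B. compact_open T B \<and> B \<subseteq> U}"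
  have "S \<subseteq> {U. openin T U}"
    by (auto simp: S_def compact_open_def)
  moreover have "U \<subseteq> \<Union>S"
  proof
    fix x assume "x \<in> U"
    then obtain B where "compact_open T B" "x \<in> B" "B \<subseteq> U"
      using bspec[OF basis] by metis
    then show "x \<in> \<Union>S"
      by (intro UnionI[of B]) (simp_all add: S_def)
  qed
  moreover have "\<Union>S \<subseteq> U"
    by (intro Union_least) (simp add: S_def)
  ultimately have "is_lub (opens_order T) U S"
    by (simp only: is_lub_opens_order subset_antisym)
  moreover have "\<forall>B\<in>S. finite_element (opens_order T) B"
    by (simp add: S_def finite_element_opens_order)
  ultimately show ?lub
    by (intro exI[of _ S] conjI)
qed

lemma coherent_frame_opens_order: "coherent_frame (opens_order T) \<longleftrightarrow> coherent_space T"
proof -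
  have "(\<forall>U\<in>carrier (opens_order T).
           \<exists>S. (\<forall>B\<in>S. finite_element (opens_order T) B) \<and> is_lub (opens_order T) U S) \<longleftrightarrow>
        (\<forall>U\<in>{U. openin T U}. \<forall>x\<in>U. \<exists>B. compact_open T B \<and> x \<in> B \<and> B \<subseteq> U)"
    unfolding opens_order_simps
    by (rule ball_cong[OF refl]) (simp only: is_lub_finite_elements_iff mem_Collect_eq)
  then have "(\<forall>U\<in>carrier (opens_order T).
           \<exists>S. (\<forall>B\<in>S. finite_element (opens_order T) B) \<and> is_lub (opens_order T) U S) \<longleftrightarrow>
        (\<forall>U x. openin T U \<longrightarrow> x \<in> U \<longrightarrow> (\<exists>B. compact_open T B \<and> x \<in> B \<and> B \<subseteq> U))"
    by (simp only: Ball_def mem_Collect_eq all_simps)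
  moreover have "compact_open T (topspace T) \<longleftrightarrow> compact_space T"
    by (simp add: compact_open_def compact_space_def)
  moreover have "A \<sqinter>\<^bsub>opens_order T\<^esub> B = A \<inter> B" if "compact_open T A" "compact_open T B" for A B
    using that by (simp add: compact_open_def meet_opens_order)
  ultimately show ?thesis
    unfolding coherent_frame_def coherent_space_def finite_element_opens_order top_opens_order
    by (simp add: frame_opens_order conj_commute cong: imp_cong)
qed

section \<open>Finite unions and intersections of compact open sets\<close>

lemma compact_open_subset: "compact_open T B \<Longrightarrow> B \<subseteq> topspace T"
  by (simp add: compact_open_def openin_subset)

lemma compact_open_empty: "compact_open T {}"
  by (simp add: compact_open_def)

lemma compact_open_Un: "compact_open T A \<Longrightarrow> compact_open T B \<Longrightarrow> compact_open T (A \<union> B)"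
  by (simp add: compact_open_def openin_Un compactin_Un)

lemma compact_open_Union:
  "finite F \<Longrightarrow> (\<And>B. B \<in> F \<Longrightarrow> compact_open T B) \<Longrightarrow> compact_open T (\<Union>F)"
  by (induction F rule: finite_induct) (auto simp: compact_open_empty compact_open_Un)

lemma coherent_space_topspace: "coherent_space T \<Longrightarrow> compact_open T (topspace T)"
  by (simp add: coherent_space_def compact_open_def compact_space_def)

lemma coherent_space_basis:
  assumes "coherent_space T" "openin T U" "x \<in> U"
  obtains B where "compact_open T B" "x \<in> B" "B \<subseteq> U"
  using assms unfolding coherent_space_def by blast

lemma coherent_space_Int:
  "coherent_space T \<Longrightarrow> compact_open T A \<Longrightarrow> compact_open T B \<Longrightarrow> compact_open T (A \<inter> B)"
  by (simp add: coherent_space_def)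

text \<open>Intersecting with \<open>topspace T\<close> gives the empty family the value
  \<open>topspace T\<close>, which is itself compact open by coherence.\<close>

lemma coherent_space_Inter:
  assumes "coherent_space T"
  shows "finite F \<Longrightarrow> (\<And>B. B \<in> F \<Longrightarrow> compact_open T B) \<Longrightarrow>
     compact_open T (topspace T \<inter> \<Inter>F)"
proof (induction F rule: finite_induct)
  case empty
  then show ?case
    using assms by (simp add: coherent_space_topspace)
next
  case (insert A F)
  then have "compact_open T (A \<inter> (topspace T \<inter> \<Inter>F))"
    by (intro coherent_space_Int[OF assms, of A "topspace T \<inter> \<Inter>F"]) simp_all
  moreover have "topspace T \<inter> \<Inter>(insert A F) = A \<inter> (topspace T \<inter> \<Inter>F)"
    by blast
  ultimately show ?case
    by simp
qed

lemma coherent_space_closure_of_eq: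
  assumes "coherent_space T" and "\<And>B. compact_open T B \<Longrightarrow> x \<in> B \<longleftrightarrow> y \<in> B"
  shows "T closure_of {x} = T closure_of {y}"
proof -
  have "x \<in> U \<longleftrightarrow> y \<in> U" if "openin T U" for U
    using coherent_space_basis[OF assms(1) that] assms(2) by (metis subsetD)
  then show ?thesis
    by (auto simp: closure_of_def)
qed

section \<open>Point closures and irreducible closed sets\<close>

lemma mem_openin_iff_closure_of:
  assumes "openin T U" "x \<in> topspace T"
  shows "x \<in> U \<longleftrightarrow> T closure_of {x} \<inter> U \<noteq> {}"
  using openin_Int_closure_of_eq_empty[OF assms(1), of "{x}"] by blast

lemma irreducible_closed_in_closure_of:
  assumes "x \<in> topspace T"
  shows "irreducible_closed_in T (T closure_of {x})"
proof -
  have x: "x \<in> T closure_of {x}"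
    using assms by (simp add: in_closure_of)
  have min: "T closure_of {x} \<subseteq> A" if "closedin T A" "x \<in> A" for A
    using that by (simp add: closure_of_minimal)
  show ?thesis
    unfolding irreducible_closed_in_def
  proof (intro conjI allI impI)
    fix A B assume "closedin T A" "closedin T B" and eq: "T closure_of {x} = A \<union> B"
    then have "T closure_of {x} \<subseteq> A \<or> T closure_of {x} \<subseteq> B"
      using x min[of A] min[of B] by (metis UnE)
    then show "T closure_of {x} = A \<or> T closure_of {x} = B"
      unfolding eq by auto
  qed (use x in auto)
qed

text \<open>Irreducibility read through open sets: if \<open>K\<close> missed the intersection, the
  closed sets \<open>K - U\<close> and \<open>K - V\<close> would cover \<open>K\<close>, so one of
  them would be all of \<open>K\<close>.\<close>

lemma irreducible_closed_in_Int:
  assumes "irreducible_closed_in T K" "openin T U" "openin T V" "K \<inter> U \<noteq> {}" "K \<inter> V \<noteq> {}"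
  shows "K \<inter> (U \<inter> V) \<noteq> {}"
proof
  assume *: "K \<inter> (U \<inter> V) = {}"
  have K: "closedin T K"
    using assms(1) by (simp add: irreducible_closed_in_def)
  have "K = (K - U) \<union> (K - V)"
    using * by blast
  then have "K = K - U \<or> K = K - V"
    using assms(1-3) K unfolding irreducible_closed_in_def by (meson closedin_diff)
  then show False
    using assms(4,5) by blast
qed

section \<open>Prime filters of compact open sets\<close>

definition prime_filter :: "'a topology \<Rightarrow> 'a set set \<Rightarrow> bool" where
  "prime_filter T P \<longleftrightarrow>
     (\<forall>B\<in>P. compact_open T B) \<and> topspace T \<in> P \<and> {} \<notin> P \<and>
     (\<forall>A\<in>P. \<forall>B. compact_open T B \<longrightarrow> A \<subseteq> B \<longrightarrow> B \<in> P) \<and>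
     (\<forall>A\<in>P. \<forall>B\<in>P. A \<inter> B \<in> P) \<and>
     (\<forall>A B. compact_open T A \<longrightarrow> compact_open T B \<longrightarrow> A \<union> B \<in> P \<longrightarrow> A \<in> P \<or> B \<in> P)"

text \<open>The irreducible closed set attached to a prime filter: what the non-members leave
  uncovered. In a coherent space, the filter of compact open neighbourhoods of a point yields the
  closure of that point.\<close>

definition filter_core :: "'a topology \<Rightarrow> 'a set set \<Rightarrow> 'a set" where
  "filter_core T P = topspace T - \<Union>{B. compact_open T B \<and> B \<notin> P}"

lemma prime_filterD:
  assumes "prime_filter T P"
  shows prime_filter_compact_open: "B \<in> P \<Longrightarrow> compact_open T B"
    and prime_filter_top: "topspace T \<in> P"
    and prime_filter_empty: "{} \<notin> P"
    and prime_filter_upward: "A \<in> P \<Longrightarrow> compact_open T B \<Longrightarrow> A \<subseteq> B \<Longrightarrow> B \<in> P"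
    and prime_filter_Int: "A \<in> P \<Longrightarrow> B \<in> P \<Longrightarrow> A \<inter> B \<in> P"
    and prime_filter_Un: "A \<union> B \<in> P \<Longrightarrow> compact_open T A \<Longrightarrow> compact_open T B \<Longrightarrow> A \<in> P \<or> B \<in> P"
  using assms unfolding prime_filter_def by metis+

text \<open>The non-members form an ideal: \<open>{}\<close> starts the induction, and primality
  lets one more set be added.\<close>

lemma prime_filter_Union:
  assumes "prime_filter T P"
  shows "finite F \<Longrightarrow> F \<subseteq> {B. compact_open T B \<and> B \<notin> P} \<Longrightarrow>
    compact_open T (\<Union>F) \<and> \<Union>F \<notin> P"
proof (induction F rule: finite_induct)
  case (insert A F)
  then have "compact_open T A" "A \<notin> P" "compact_open T (\<Union>F)" "\<Union>F \<notin> P"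
    by simp_all
  then have "compact_open T (A \<union> \<Union>F)" "A \<union> \<Union>F \<notin> P"
    using prime_filter_Un[OF assms, of A "\<Union>F"] compact_open_Un[of T A "\<Union>F"] by blast+
  then show ?case
    by simp
qed (use prime_filter_empty[OF assms] in \<open>simp add: compact_open_empty\<close>)

text \<open>A member that missed the core would be covered by non-members. By compactness finitely
  many suffice, their union is again a non-member, and this contradicts upward closure.\<close>

lemma filter_core_meets:
  assumes "prime_filter T P" "compact_open T B"
  shows "filter_core T P \<inter> B \<noteq> {} \<longleftrightarrow> B \<in> P"
proof
  show "B \<in> P" if "filter_core T P \<inter> B \<noteq> {}"
    using that assms(2) by (auto simp: filter_core_def)
  assume "B \<in> P"
  show "filter_core T P \<inter> B \<noteq> {}"
  proof
    assume "filter_core T P \<inter> B = {}"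
    then have "B \<subseteq> \<Union>{B. compact_open T B \<and> B \<notin> P}"
      using compact_open_subset[OF assms(2)] by (auto simp: filter_core_def)
    moreover have "compactin T B"
      using assms(2) by (simp add: compact_open_def)
    ultimately obtain F where F: "finite F" "F \<subseteq> {B. compact_open T B \<and> B \<notin> P}" "B \<subseteq> \<Union>F"
      using compactinD[of T B "{B. compact_open T B \<and> B \<notin> P}"] by (auto simp: compact_open_def)
    then show False
      using prime_filter_Union[OF assms(1) F(1,2)]
        prime_filter_upward[OF assms(1) \<open>B \<in> P\<close> _ F(3)] by simp
  qed
qed

lemma irreducible_closed_in_filter_core:
  assumes T: "coherent_space T" and P: "prime_filter T P"
  shows "irreducible_closed_in T (filter_core T P)"
  unfolding irreducible_closed_in_def
proof (intro conjI allI impI)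
  show "closedin T (filter_core T P)"
    unfolding filter_core_def by (intro closedin_diff openin_Union) (auto simp: compact_open_def)
  show "filter_core T P \<noteq> {}"
    using filter_core_meets[OF P coherent_space_topspace[OF T]] prime_filter_top[OF P] by blast
  fix A B assume A: "closedin T A" and B: "closedin T B" and K: "filter_core T P = A \<union> B"
  \<comment> \<open>A point of the core outside \<open>E\<close> has a compact open neighbourhood
    disjoint from \<open>E\<close>; since it meets the core, it is a member. Two such members for
    \<open>A\<close> and \<open>B\<close> intersect in a member that misses the whole core.\<close>
  have pick: "\<exists>D\<in>P. D \<inter> E = {}" if E: "closedin T E" "\<not> filter_core T P \<subseteq> E" for E
  proof -
    obtain x where x: "x \<in> filter_core T P" "x \<notin> E"
      using E by blast
    then have "x \<in> topspace T - E"
      by (auto simp: filter_core_def)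
    then obtain D where "compact_open T D" "x \<in> D" "D \<subseteq> topspace T - E"
      using coherent_space_basis[OF T] E(1) by (metis openin_diff openin_topspace)
    then show ?thesis
      using filter_core_meets[OF P, of D] x(1) by blast
  qed
  show "filter_core T P = A \<or> filter_core T P = B"
  proof (rule ccontr)
    assume "\<not> ?thesis"
    then obtain D E where "D \<in> P" "D \<inter> A = {}" "E \<in> P" "E \<inter> B = {}"
      using pick[OF A] pick[OF B] K by blast
    then show False
      using filter_core_meets[OF P, of "D \<inter> E"] prime_filter_Int[OF P, of D E]
        prime_filter_compact_open[OF P, of "D \<inter> E"] K by blast
  qed
qed

text \<open>The two cores satisfy the conditions of d-sobriety for arbitrary open sets, although
  \<open>meet\<close> and \<open>cover\<close> speak of compact open sets alone. Condition (i)
  follows by shrinking to compact open neighbourhoods, condition (ii) from compactness of the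
  join.\<close>

lemma d_sober_prime_filters:
  assumes sp: "bitop_space Tp Tm" "bitop_compact Tp Tm" "d_sober Tp Tm"
    and coh: "coherent_space Tp" "coherent_space Tm"
    and P: "prime_filter Tp P" and Q: "prime_filter Tm Q"
    and meet: "\<And>B C. B \<in> P \<Longrightarrow> C \<in> Q \<Longrightarrow> B \<inter> C \<noteq> {}"
    and cover: "\<And>B C. compact_open Tp B \<Longrightarrow> B \<notin> P \<Longrightarrow> compact_open Tm C \<Longrightarrow> C \<notin> Q \<Longrightarrow>
                  B \<union> C \<noteq> topspace Tp"
  obtains x where "x \<in> topspace Tp"
    "\<And>B. compact_open Tp B \<Longrightarrow> x \<in> B \<longleftrightarrow> B \<in> P" "\<And>C. compact_open Tm C \<Longrightarrow> x \<in> C \<longleftrightarrow> C \<in> Q"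
proof -
  define I where "I = {B. compact_open Tp B \<and> B \<notin> P}"
  define J where "J = {C. compact_open Tm C \<and> C \<notin> Q}"
  let ?K = "filter_core Tp P" and ?L = "filter_core Tm Q"
  have X: "topspace Tp = topspace Tm"
    using sp by (simp add: bitop_space_def)
  have disj: "?K \<inter> U = {} \<or> ?L \<inter> V = {}"
    if U: "openin Tp U" and V: "openin Tm V" and UV: "U \<inter> V = {}" for U V
  proof (rule ccontr)
    assume "\<not> ?thesis"
    then obtain x y where x: "x \<in> ?K" "x \<in> U" and y: "y \<in> ?L" "y \<in> V"
      by blast
    obtain B where B: "compact_open Tp B" "x \<in> B" "B \<subseteq> U"
      using coherent_space_basis[OF coh(1) U x(2)] .
    obtain C where C: "compact_open Tm C" "y \<in> C" "C \<subseteq> V"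
      using coherent_space_basis[OF coh(2) V y(2)] .
    have "B \<in> P" "C \<in> Q"
      using B C x y filter_core_meets[OF P, of B] filter_core_meets[OF Q, of C] by blast+
    then show False
      using meet B C UV by blast
  qed
  have cov: "?K \<inter> U \<noteq> {} \<or> ?L \<inter> V \<noteq> {}"
    if U: "openin Tp U" and V: "openin Tm V" and UV: "U \<union> V = topspace Tp" for U V
  proof (rule ccontr)
    assume "\<not> ?thesis"
    \<comment> \<open>An open set that misses a core is covered by the non-members of that filter,
      so here the non-members of both filters together cover the space.\<close>
    then have "U \<subseteq> \<Union>I" "V \<subseteq> \<Union>J"
      using openin_subset[OF U] openin_subset[OF V] by (auto simp: filter_core_def I_def J_def)
    then have "topspace (topology_join Tp Tm) \<subseteq> \<Union>(I \<union> J)"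
      using UV topspace_topology_join[OF sp(1)] by auto
    moreover have "\<forall>U\<in>I \<union> J. openin (topology_join Tp Tm) U"
      by (auto simp: I_def J_def compact_open_def intro: openin_topology_join)
    ultimately obtain F where F: "finite F" "F \<subseteq> I \<union> J" "topspace Tp \<subseteq> \<Union>F"
      using sp(2) topspace_topology_join[OF sp(1)]
      unfolding bitop_compact_def compact_space_alt by metis
    \<comment> \<open>The finite subcover is sorted by origin; each part has a union that is again a
      non-member, which brings the situation under \<open>cover\<close>.\<close>
    let ?B = "\<Union>(F \<inter> I)" and ?C = "\<Union>(F \<inter> J)"
    have B: "compact_open Tp ?B \<and> ?B \<notin> P"
      by (rule prime_filter_Union[OF P]) (use F(1) in \<open>auto simp: I_def\<close>)
    have C: "compact_open Tm ?C \<and> ?C \<notin> Q"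
      by (rule prime_filter_Union[OF Q]) (use F(1) in \<open>auto simp: J_def\<close>)
    have "?B \<subseteq> topspace Tp" "?C \<subseteq> topspace Tp"
      using B C X compact_open_subset[of Tp ?B] compact_open_subset[of Tm ?C] by simp_all
    moreover have "\<Union>F \<subseteq> ?B \<union> ?C"
      using F(2) by blast
    ultimately have "?B \<union> ?C = topspace Tp"
      by (metis F(3) Un_least order_trans subset_antisym)
    then show False
      using cover[OF conjunct1[OF B] conjunct2[OF B] conjunct1[OF C] conjunct2[OF C]]
      by contradiction
  qed
  obtain x where x: "x \<in> topspace Tp" "?K = Tp closure_of {x}" "?L = Tm closure_of {x}"
    using sp(3) irreducible_closed_in_filter_core[OF coh(1) P]
      irreducible_closed_in_filter_core[OF coh(2) Q] disj cov
    unfolding d_sober_def by metis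
  show ?thesis
  proof
    show "x \<in> topspace Tp"
      by (fact x(1))
    show "x \<in> B \<longleftrightarrow> B \<in> P" if "compact_open Tp B" for B
      using mem_openin_iff_closure_of[of Tp B x] filter_core_meets[OF P that] that x
      by (simp add: compact_open_def)
    show "x \<in> C \<longleftrightarrow> C \<in> Q" if "compact_open Tm C" for C
      using mem_openin_iff_closure_of[of Tm C x] filter_core_meets[OF Q that] that x X
      by (simp add: compact_open_def)
  qed
qed

text \<open>This is the uniqueness half of d-sobriety: the pair of closures of \<open>x\<close>
  satisfies its conditions, and \<open>y\<close> has the same two closures because compact open sets
  form bases.\<close>

lemma d_sober_separates:
  assumes sp: "bitop_space Tp Tm" "d_sober Tp Tm"
    and coh: "coherent_space Tp" "coherent_space Tm"
    and xy: "x \<in> topspace Tp" "y \<in> topspace Tp"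
    and eqp: "\<And>B. compact_open Tp B \<Longrightarrow> x \<in> B \<longleftrightarrow> y \<in> B"
    and eqm: "\<And>B. compact_open Tm B \<Longrightarrow> x \<in> B \<longleftrightarrow> y \<in> B"
  shows "x = y"
proof -
  have X: "topspace Tp = topspace Tm"
    using sp by (simp add: bitop_space_def)
  \<comment> \<open>An open set meets the closure of \<open>x\<close> exactly when it contains
    \<open>x\<close>, so both conditions become statements about membership of
    \<open>x\<close>.\<close>
  have cond: "(U \<inter> V = {} \<longrightarrow> Tp closure_of {x} \<inter> U = {} \<or> Tm closure_of {x} \<inter> V = {}) \<and>
        (U \<union> V = topspace Tp \<longrightarrow> Tp closure_of {x} \<inter> U \<noteq> {} \<or> Tm closure_of {x} \<inter> V \<noteq> {})"
    if "openin Tp U" "openin Tm V" for U V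
    using mem_openin_iff_closure_of[OF that(1) xy(1)] mem_openin_iff_closure_of[OF that(2), of x]
      xy(1) X by blast
  have "\<exists>!z. z \<in> topspace Tp \<and> Tp closure_of {x} = Tp closure_of {z} \<and>
      Tm closure_of {x} = Tm closure_of {z}"
  proof (rule sp(2)[unfolded d_sober_def, THEN spec, THEN spec, THEN mp, THEN mp, THEN mp])
    show "irreducible_closed_in Tp (Tp closure_of {x})" "irreducible_closed_in Tm (Tm closure_of {x})"
      using xy(1) X by (simp_all add: irreducible_closed_in_closure_of)
  qed (intro allI impI cond)
  moreover have "Tp closure_of {x} = Tp closure_of {y}" "Tm closure_of {x} = Tm closure_of {y}"
    using coherent_space_closure_of_eq[OF coh(1) eqp] coherent_space_closure_of_eq[OF coh(2) eqm]
    by auto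
  ultimately show ?thesis
    using xy by blast
qed

section \<open>The co-compact topology\<close>

text \<open>Open sets are upper sets for the specialization preorder, so a compact open set is
  compact saturated and its complement is a subbasic open set.\<close>

lemma openin_cocompact_topology_compact_open:
  assumes "compact_open T B"
  shows "openin (cocompact_topology T) (topspace T - B)"
proof -
  have "saturated_in T B"
    using assms openin_subset
    by (auto simp: saturated_in_def compact_open_def specialization_le_def in_closure_of)
  then show ?thesis
    using assms unfolding cocompact_topology_def compact_open_def
    by (intro topology_generated_by_Basis) blast
qed

text \<open>A point \<open>y\<close> of \<open>K\<close> is not in the closure of \<open>x\<close>,
  since saturation would then put \<open>x\<close> into \<open>K\<close>. Hence \<open>y\<close> has
  a compact open neighbourhood without \<open>x\<close>, and finitely many of these cover
  \<open>K\<close>.\<close>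

lemma saturated_compact_avoid:
  assumes T: "coherent_space T" and K: "compactin T K" "saturated_in T K"
    and x: "x \<in> topspace T" "x \<notin> K"
  obtains B where "compact_open T B" "K \<subseteq> B" "x \<notin> B"
proof -
  have "\<exists>B. compact_open T B \<and> y \<in> B \<and> x \<notin> B" if y: "y \<in> K" for y
  proof -
    have "y \<in> topspace T" "y \<notin> T closure_of {x}"
      using K(2) x y by (auto simp: saturated_in_def specialization_le_def)
    then obtain U where U: "openin T U" "y \<in> U" "x \<notin> U"
      by (auto simp: in_closure_of)
    then show ?thesis
      using coherent_space_basis[OF T U(1,2)] by blast
  qed
  then have "K \<subseteq> \<Union>{B. compact_open T B \<and> x \<notin> B}"
    by blast
  then obtain F where F: "finite F" "F \<subseteq> {B. compact_open T B \<and> x \<notin> B}" "K \<subseteq> \<Union>F"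
    using compactinD[OF K(1), of "{B. compact_open T B \<and> x \<notin> B}"] by (auto simp: compact_open_def)
  then have "compact_open T (\<Union>F)"
    by (intro compact_open_Union) auto
  then show ?thesis
    using that F by blast
qed

text \<open>Complements of compact open sets form a basis: they are stable under intersection
  because compact open sets are stable under union, and \<open>saturated_compact_avoid\<close>
  handles the subbasic sets.\<close>

lemma cocompact_topology_basis:
  assumes T: "coherent_space T" and "openin (cocompact_topology T) U" "x \<in> U"
  obtains B where "compact_open T B" "x \<notin> B" "topspace T - B \<subseteq> U"
proof -
  have "generate_topology_on {topspace T - K |K. compactin T K \<and> saturated_in T K} U"
    using assms(2) unfolding cocompact_topology_def by (rule openin_topology_generated_by)
  then have "\<forall>x\<in>U. \<exists>B. compact_open T B \<and> x \<notin> B \<and> topspace T - B \<subseteq> U"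
  proof induction
    case (Int a b)
    show ?case
    proof
      fix x assume x: "x \<in> a \<inter> b"
      obtain A where A: "compact_open T A" "x \<notin> A" "topspace T - A \<subseteq> a"
        using bspec[OF Int.IH(1) IntD1[OF x]] by blast
      obtain B where B: "compact_open T B" "x \<notin> B" "topspace T - B \<subseteq> b"
        using bspec[OF Int.IH(2) IntD2[OF x]] by blast
      show "\<exists>B. compact_open T B \<and> x \<notin> B \<and> topspace T - B \<subseteq> a \<inter> b"
        using A B compact_open_Un[OF A(1) B(1)] by (intro exI[of _ "A \<union> B"]) blast
    qed
  next
    case (UN K)
    show ?case
    proof
      fix x assume "x \<in> \<Union>K"
      then obtain k where k: "k \<in> K" "x \<in> k"
        by blast
      then obtain B where "compact_open T B" "x \<notin> B" "topspace T - B \<subseteq> k"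
        using UN.IH by blast
      then show "\<exists>B. compact_open T B \<and> x \<notin> B \<and> topspace T - B \<subseteq> \<Union>K"
        using k(1) by blast
    qed
  next
    case (Basis s)
    then obtain K where K: "s = topspace T - K" "compactin T K" "saturated_in T K"
      by blast
    show ?case
    proof
      fix x assume "x \<in> s"
      then have "x \<in> topspace T" "x \<notin> K"
        using K(1) by auto
      then obtain B where "compact_open T B" "K \<subseteq> B" "x \<notin> B"
        using saturated_compact_avoid[OF T K(2,3)] by blast
      then show "\<exists>B. compact_open T B \<and> x \<notin> B \<and> topspace T - B \<subseteq> s"
        using K(1) by blast
    qed
  qed simp
  then show ?thesis
    using assms(3) that by blast
qed

text \<open>A compact open set of the co-compact topology is a finite union of basic sets, so its
  complement is a finite intersection of compact open sets of \<open>T\<close>, which coherence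
  makes compact open. The converse rests on \<open>cpt\<close>, supplied later by compactness of a
  finer topology.\<close>

lemma compact_open_cocompact_topology:
  assumes T: "coherent_space T"
    and cpt: "\<And>B. compact_open T B \<Longrightarrow> compactin (cocompact_topology T) (topspace T - B)"
  shows "compact_open (cocompact_topology T) C \<longleftrightarrow> (\<exists>B. compact_open T B \<and> C = topspace T - B)"
proof
  assume C: "compact_open (cocompact_topology T) C"
  define \<U> where "\<U> = {B. compact_open T B \<and> topspace T - B \<subseteq> C}"
  have "C \<subseteq> \<Union>((\<lambda>B. topspace T - B) ` \<U>)"
  proof
    fix x assume "x \<in> C"
    then obtain B where "compact_open T B" "x \<notin> B" "topspace T - B \<subseteq> C"
      using cocompact_topology_basis[OF T, of C x] C by (auto simp: compact_open_def)
    moreover have "x \<in> topspace T"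
      using \<open>x \<in> C\<close> compact_open_subset[OF C] by auto
    ultimately show "x \<in> \<Union>((\<lambda>B. topspace T - B) ` \<U>)"
      by (auto simp: \<U>_def)
  qed
  moreover have "\<And>U. U \<in> (\<lambda>B. topspace T - B) ` \<U> \<Longrightarrow> openin (cocompact_topology T) U"
    by (auto simp: \<U>_def openin_cocompact_topology_compact_open)
  ultimately obtain \<F> where \<F>: "finite \<F>" "\<F> \<subseteq> (\<lambda>B. topspace T - B) ` \<U>" "C \<subseteq> \<Union>\<F>"
    using compactinD[of "cocompact_topology T" C] C unfolding compact_open_def by metis
  then obtain F where F: "finite F" "F \<subseteq> \<U>" "\<F> = (\<lambda>B. topspace T - B) ` F"
    by (metis finite_subset_image)
  have "compact_open T (topspace T \<inter> \<Inter>F)"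
    using F by (intro coherent_space_Inter[OF T]) (auto simp: \<U>_def)
  moreover have "C = topspace T - (topspace T \<inter> \<Inter>F)"
    using F \<F>(3) unfolding \<U>_def by blast
  ultimately show "\<exists>B. compact_open T B \<and> C = topspace T - B"
    by blast
next
  assume "\<exists>B. compact_open T B \<and> C = topspace T - B"
  then show "compact_open (cocompact_topology T) C"
    using cpt openin_cocompact_topology_compact_open
    unfolding compact_open_def[of "cocompact_topology T"] by blast
qed

lemma coherent_space_cocompact_topology:
  assumes T: "coherent_space T"
    and cpt: "\<And>B. compact_open T B \<Longrightarrow> compactin (cocompact_topology T) (topspace T - B)"
  shows "coherent_space (cocompact_topology T)"
  unfolding coherent_space_def
proof (intro conjI allI impI)
  have co: "compact_open (cocompact_topology T) C \<longleftrightarrow>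
      (\<exists>B. compact_open T B \<and> C = topspace T - B)" for C
    using compact_open_cocompact_topology[OF T] cpt by blast
  \<comment> \<open>The whole space is the complement of the compact open set
    \<open>{}\<close>.\<close>
  show "compact_space (cocompact_topology T)"
    using cpt[OF compact_open_empty] by (simp add: compact_space_def)
  show "compact_open (cocompact_topology T) (A \<inter> B)"
    if A: "compact_open (cocompact_topology T) A" and B: "compact_open (cocompact_topology T) B"
    for A B
  proof -
    obtain A' B' where "compact_open T A'" "A = topspace T - A'"
      "compact_open T B'" "B = topspace T - B'"
      using A B unfolding co by blast
    then show ?thesis
      unfolding co by (intro exI[of _ "A' \<union> B'"]) (auto intro: compact_open_Un)
  qed
  show "\<exists>B. compact_open (cocompact_topology T) B \<and> x \<in> B \<and> B \<subseteq> U"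
    if U: "openin (cocompact_topology T) U" "x \<in> U" for U x
  proof -
    obtain B where "compact_open T B" "x \<notin> B" "topspace T - B \<subseteq> U"
      using cocompact_topology_basis[OF T U] .
    moreover have "x \<in> topspace T"
      using openin_subset[OF U(1)] U(2) by auto
    ultimately show ?thesis
      unfolding co by blast
  qed
qed

text \<open>For primality: if \<open>K\<close> lies in neither \<open>A\<close> nor
  \<open>B\<close>, it meets both complements, which are open in the co-compact topology. By
  irreducibility it meets their intersection, the complement of \<open>A \<union> B\<close>.\<close>

lemma irreducible_closed_in_cocompact_prime_filter:
  assumes T: "coherent_space T" and K: "irreducible_closed_in (cocompact_topology T) K"
  shows "prime_filter T {B. compact_open T B \<and> K \<subseteq> B}"
proof -
  have KX: "K \<subseteq> topspace T" and "K \<noteq> {}"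
    using K closedin_subset[of "cocompact_topology T"] by (auto simp: irreducible_closed_in_def)
  have "K \<subseteq> A \<or> K \<subseteq> B"
    if "compact_open T A" "compact_open T B" "K \<subseteq> A \<union> B" for A B
    using irreducible_closed_in_Int[OF K openin_cocompact_topology_compact_open[OF that(1)]
        openin_cocompact_topology_compact_open[OF that(2)]] that(3) KX by blast
  then show ?thesis
    using \<open>K \<noteq> {}\<close> KX coherent_space_topspace[OF T] coherent_space_Int[OF T]
    unfolding prime_filter_def by auto
qed

text \<open>By the basis of complements, a closed set of the co-compact topology is the intersection
  of the compact open sets of \<open>T\<close> that contain it. By \<open>mem\<close>, the sets
  containing \<open>K\<close> are those containing \<open>x\<close>.\<close>

lemma cocompact_topology_closure_of:
  assumes T: "coherent_space T" and x: "x \<in> topspace T"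
    and K: "closedin (cocompact_topology T) K"
    and mem: "\<And>B. compact_open T B \<Longrightarrow> x \<in> B \<longleftrightarrow> K \<subseteq> B"
  shows "K = cocompact_topology T closure_of {x}"
proof (rule Set.set_eqI)
  fix z
  have KX: "K \<subseteq> topspace T"
    using closedin_subset[OF K] by simp
  show "z \<in> K \<longleftrightarrow> z \<in> cocompact_topology T closure_of {x}"
  proof
    assume "z \<in> K"
    have "x \<in> U" if U: "openin (cocompact_topology T) U" "z \<in> U" for U
    proof -
      obtain B where B: "compact_open T B" "z \<notin> B" "topspace T - B \<subseteq> U"
        using cocompact_topology_basis[OF T U] .
      then have "x \<notin> B"
        using mem \<open>z \<in> K\<close> by blast
      then show ?thesis
        using x B(3) by blast
    qed
    then show "z \<in> cocompact_topology T closure_of {x}"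
      using \<open>z \<in> K\<close> KX by (auto simp: in_closure_of)
  next
    assume z: "z \<in> cocompact_topology T closure_of {x}"
    show "z \<in> K"
    proof (rule ccontr)
      assume "z \<notin> K"
      then have "z \<in> topspace T - K" "openin (cocompact_topology T) (topspace T - K)"
        using z K by (auto simp: in_closure_of closedin_def)
      then obtain B where B: "compact_open T B" "z \<notin> B" "topspace T - B \<subseteq> topspace T - K"
        using cocompact_topology_basis[OF T] by metis
      have "z \<in> topspace T"
        using z by (simp add: in_closure_of)
      moreover have "x \<in> B"
        using mem B KX by blast
      ultimately show False
        using z B openin_cocompact_topology_compact_open[OF B(1)] by (auto simp: in_closure_of)
    qed
  qed
qed

lemma cocompact_topology_closure_of_eqD:
  assumes "cocompact_topology T closure_of {x} = cocompact_topology T closure_of {y}"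
    and "x \<in> topspace T" "y \<in> topspace T" "compact_open T B"
  shows "x \<in> B \<longleftrightarrow> y \<in> B"
  using mem_openin_iff_closure_of[OF openin_cocompact_topology_compact_open[OF assms(4)], of x]
    mem_openin_iff_closure_of[OF openin_cocompact_topology_compact_open[OF assms(4)], of y]
    assms(1-3) by auto

section \<open>The dual and the patch space\<close>

lemma d_sober_cocompact_topology:
  assumes sp: "bitop_space Tp Tm" "bitop_compact Tp Tm" "d_sober Tp Tm"
    and coh: "coherent_space Tp" "coherent_space Tm"
  shows "d_sober (cocompact_topology Tp) (cocompact_topology Tm)"
  unfolding d_sober_def
proof (intro allI impI)
  fix K L assume K: "irreducible_closed_in (cocompact_topology Tp) K"
    and L: "irreducible_closed_in (cocompact_topology Tm) L"
    and KL: "\<forall>U V. openin (cocompact_topology Tp) U \<longrightarrow> openin (cocompact_topology Tm) V \<longrightarrow>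
      (U \<inter> V = {} \<longrightarrow> K \<inter> U = {} \<or> L \<inter> V = {}) \<and>
      (U \<union> V = topspace (cocompact_topology Tp) \<longrightarrow> K \<inter> U \<noteq> {} \<or> L \<inter> V \<noteq> {})"
  let ?P = "{B. compact_open Tp B \<and> K \<subseteq> B}" and ?Q = "{C. compact_open Tm C \<and> L \<subseteq> C}"
  have X: "topspace Tp = topspace Tm"
    using sp by (simp add: bitop_space_def)
  have KX: "closedin (cocompact_topology Tp) K" "closedin (cocompact_topology Tm) L"
    using K L by (auto simp: irreducible_closed_in_def)
  then have KLX: "K \<subseteq> topspace Tp" "L \<subseteq> topspace Tp"
    using closedin_subset X by fastforce+
  \<comment> \<open>In terms of complements, condition (i) of the dual says that non-members never
    cover the space, and condition (ii) says that members always meet.\<close>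
  have compl: "((topspace Tp - B) \<inter> (topspace Tp - C) = {} \<longrightarrow> K \<subseteq> B \<or> L \<subseteq> C) \<and>
      ((topspace Tp - B) \<union> (topspace Tp - C) = topspace Tp \<longrightarrow> \<not> K \<subseteq> B \<or> \<not> L \<subseteq> C)"
    if "compact_open Tp B" "compact_open Tm C" for B C
    using KL[rule_format, OF openin_cocompact_topology_compact_open[OF that(1)]
        openin_cocompact_topology_compact_open[OF that(2)]] X KLX by auto
  obtain x where x: "x \<in> topspace Tp"
    "\<And>B. compact_open Tp B \<Longrightarrow> x \<in> B \<longleftrightarrow> B \<in> ?P" "\<And>C. compact_open Tm C \<Longrightarrow> x \<in> C \<longleftrightarrow> C \<in> ?Q"
  proof (rule d_sober_prime_filters[OF sp coh irreducible_closed_in_cocompact_prime_filter[OF coh(1) K]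
          irreducible_closed_in_cocompact_prime_filter[OF coh(2) L]])
    show "B \<inter> C \<noteq> {}" if "B \<in> ?P" "C \<in> ?Q" for B C
      using compl[of B C] that by blast
    show "B \<union> C \<noteq> topspace Tp"
      if "compact_open Tp B" "B \<notin> ?P" "compact_open Tm C" "C \<notin> ?Q" for B C
      using compl[of B C] that by blast
  qed blast
  show "\<exists>!x. x \<in> topspace (cocompact_topology Tp) \<and>
      K = cocompact_topology Tp closure_of {x} \<and> L = cocompact_topology Tm closure_of {x}"
  proof (rule ex1I[of _ x])
    show *: "x \<in> topspace (cocompact_topology Tp) \<and>
      K = cocompact_topology Tp closure_of {x} \<and> L = cocompact_topology Tm closure_of {x}"
      using x X cocompact_topology_closure_of[OF coh(1) _ KX(1)]
        cocompact_topology_closure_of[OF coh(2) _ KX(2)] by simp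
    fix y assume y: "y \<in> topspace (cocompact_topology Tp) \<and>
      K = cocompact_topology Tp closure_of {y} \<and> L = cocompact_topology Tm closure_of {y}"
    \<comment> \<open>Equal closures in the dual mean membership in the same compact open sets of
      the original topologies, which separate points.\<close>
    show "y = x"
    proof (rule d_sober_separates[OF sp(1,3) coh])
      show "y \<in> topspace Tp" "x \<in> topspace Tp"
        using x y by auto
      show "y \<in> B \<longleftrightarrow> x \<in> B" if "compact_open Tp B" for B
        by (rule cocompact_topology_closure_of_eqD) (use * y that in auto)
      show "y \<in> B \<longleftrightarrow> x \<in> B" if "compact_open Tm B" for B
        by (rule cocompact_topology_closure_of_eqD) (use * y that X in auto)
    qed
  qed
qed

section \<open>Patch topologies: compactness of their join and clopen bases\<close>

abbreviation patch_topology :: "'a topology \<Rightarrow> 'a topology \<Rightarrow> 'a topology" where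
  "patch_topology S T \<equiv> topology_join S (cocompact_topology T)"

lemma topspace_patch_topology:
  "topspace S = topspace T \<Longrightarrow> topspace (patch_topology S T) = topspace S"
  by (simp add: topspace_topology_join bitop_space_def)

lemma ultrafilter_on_compact_open_prime_filter:
  assumes T: "coherent_space T" and M: "ultrafilter_on (topspace T) M"
  shows "prime_filter T {B. compact_open T B \<and> B \<in> M}"
  using coherent_space_topspace[OF T] coherent_space_Int[OF T] M
    ultrafilter_on_upward[OF M _ _ compact_open_subset]
    ultrafilter_on_Un[OF M _ compact_open_subset compact_open_subset]
  unfolding prime_filter_def by (auto simp: ultrafilter_on_def)

lemma bitop_compact_patch:
  assumes sp: "bitop_space Tp Tm" "bitop_compact Tp Tm" "d_sober Tp Tm"
    and coh: "coherent_space Tp" "coherent_space Tm"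
  shows "bitop_compact (patch_topology Tp Tm) (patch_topology Tm Tp)"
  unfolding bitop_compact_def
proof (rule compact_space_ultrafilterI)
  have X: "topspace Tp = topspace Tm"
    using sp by (simp add: bitop_space_def)
  then have XJ: "topspace (topology_join (patch_topology Tp Tm) (patch_topology Tm Tp)) = topspace Tp"
    by (simp add: topspace_topology_join bitop_space_def topspace_patch_topology)
  fix M assume "ultrafilter_on (topspace (topology_join (patch_topology Tp Tm) (patch_topology Tm Tp))) M"
  then have M: "ultrafilter_on (topspace Tp) M"
    by (simp add: XJ)
  let ?P = "{B. compact_open Tp B \<and> B \<in> M}" and ?Q = "{C. compact_open Tm C \<and> C \<in> M}"
  \<comment> \<open>The compact open sets in an ultrafilter satisfy both conditions: members of
    \<open>M\<close> intersect, and a cover of the space by two sets has one of them in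
    \<open>M\<close>.\<close>
  obtain x where x: "x \<in> topspace Tp"
    "\<And>B. compact_open Tp B \<Longrightarrow> x \<in> B \<longleftrightarrow> B \<in> ?P" "\<And>C. compact_open Tm C \<Longrightarrow> x \<in> C \<longleftrightarrow> C \<in> ?Q"
  proof (rule d_sober_prime_filters[OF sp coh ultrafilter_on_compact_open_prime_filter[OF coh(1) M]
          ultrafilter_on_compact_open_prime_filter[OF coh(2)]])
    show "ultrafilter_on (topspace Tm) M"
      using M X by simp
    show "B \<inter> C \<noteq> {}" if "B \<in> ?P" "C \<in> ?Q" for B C
      using ultrafilter_on_disjoint[OF M] that by blast
    show "B \<union> C \<noteq> topspace Tp"
      if "compact_open Tp B" "B \<notin> ?P" "compact_open Tm C" "C \<notin> ?Q" for B C
      using ultrafilter_on_Un[OF M, of B C] that compact_open_subset[of Tp B]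
        compact_open_subset[of Tm C] X M by (auto simp: ultrafilter_on_def)
  qed blast
  have lim: "U \<in> M"
    if T: "coherent_space T" "topspace T = topspace Tp" "\<And>B. compact_open T B \<Longrightarrow> x \<in> B \<longleftrightarrow> B \<in> M"
      and U: "openin T U" "x \<in> U" for T U
  proof -
    obtain B where "compact_open T B" "x \<in> B" "B \<subseteq> U"
      using coherent_space_basis[OF T(1) U] .
    then show ?thesis
      using T(2,3) ultrafilter_on_upward[OF M, of B U] openin_subset[OF U(1)] by auto
  qed
  \<comment> \<open>A basic neighbourhood of \<open>x\<close> is the complement of a compact open
    \<open>B\<close> not containing \<open>x\<close>; then \<open>B\<close> is not in
    \<open>M\<close>, so its complement is.\<close>
  have colim: "U \<in> M"
    if T: "coherent_space T" "topspace T = topspace Tp" "\<And>B. compact_open T B \<Longrightarrow> x \<in> B \<longleftrightarrow> B \<in> M"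
      and U: "openin (cocompact_topology T) U" "x \<in> U" for T U
  proof -
    obtain B where B: "compact_open T B" "x \<notin> B" "topspace T - B \<subseteq> U"
      using cocompact_topology_basis[OF T(1) U] .
    have "B \<subseteq> topspace Tp" "B \<notin> M"
      using T(2) T(3)[OF B(1)] B(2) compact_open_subset[OF B(1)] by simp_all
    then have "topspace Tp - B \<in> M"
      by (rule ultrafilter_on_Diff[OF M])
    then show ?thesis
      by (rule ultrafilter_on_upward[OF M]) (use B(3) T(2) openin_subset[OF U(1)] in auto)
  qed
  \<comment> \<open>Stated for arbitrary \<open>S\<close> and \<open>T\<close> because the two patch
    topologies arise from each other by exchanging the given topologies.\<close>
  have patch: "U \<in> M"
    if "coherent_space S" "topspace S = topspace Tp" "\<And>B. compact_open S B \<Longrightarrow> x \<in> B \<longleftrightarrow> B \<in> M"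
      and "coherent_space T" "topspace T = topspace Tp" "\<And>B. compact_open T B \<Longrightarrow> x \<in> B \<longleftrightarrow> B \<in> M"
      and "openin (patch_topology S T) U" "x \<in> U" for S T U
    by (rule ultrafilter_on_join[OF M _ _ lim[OF that(1-3)] colim[OF that(4-6)] that(7,8)])
       (use that(2,5) in simp_all)
  have xp: "\<And>B. compact_open Tp B \<Longrightarrow> x \<in> B \<longleftrightarrow> B \<in> M" and xm: "\<And>B. compact_open Tm B \<Longrightarrow> x \<in> B \<longleftrightarrow> B \<in> M"
    using x by auto
  have "U \<in> M"
    if "openin (topology_join (patch_topology Tp Tm) (patch_topology Tm Tp)) U" "x \<in> U" for U
    by (rule ultrafilter_on_join[OF M _ _ patch[OF coh(1) refl xp coh(2) X[symmetric] xm]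
          patch[OF coh(2) X[symmetric] xm coh(1) refl xp] that])
       (simp_all add: topspace_patch_topology X)
  then show "\<exists>x\<in>topspace (topology_join (patch_topology Tp Tm) (patch_topology Tm Tp)).
      \<forall>U. openin (topology_join (patch_topology Tp Tm) (patch_topology Tm Tp)) U \<longrightarrow> x \<in> U \<longrightarrow> U \<in> M"
    using x(1) XJ by auto
qed

text \<open>A compact open set of \<open>S\<close> is open in the first patch topology, and its
  complement is open in the co-compact topology of \<open>S\<close>, a part of the second. For
  complements of compact open sets of \<open>T\<close> the two roles are exchanged.\<close>

lemma patch_topology_clopen_basis:
  assumes X: "topspace S = topspace T" and coh: "coherent_space S" "coherent_space T"
  shows "\<exists>P. openin (patch_topology S T) = arbitrary union_of P \<and>
             (\<forall>B. P B \<longrightarrow> closedin (patch_topology T S) B)"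
proof (intro exI conjI allI impI)
  let ?P = "\<lambda>B. openin (patch_topology S T) B \<and> closedin (patch_topology T S) B"
  show "closedin (patch_topology T S) B" if "?P B" for B
    using that by blast
  have "\<exists>B. ?P B \<and> x \<in> B \<and> B \<subseteq> U" if U: "openin (patch_topology S T) U" "x \<in> U" for U x
  proof -
    have *: "\<exists>B. ?P B \<and> y \<in> B \<and> B \<subseteq> V"
      if V: "V \<in> {U. openin S U} \<union> {U. openin (cocompact_topology T) U}" "y \<in> V" for V y
      using V(1)
    proof
      assume "V \<in> {U. openin S U}"
      then obtain B where B: "compact_open S B" "y \<in> B" "B \<subseteq> V"
        using coherent_space_basis[OF coh(1), of V y] V(2) by blast
      have "openin (patch_topology S T) B"
        using B(1) by (simp add: compact_open_def openin_topology_join)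
      moreover have "closedin (patch_topology T S) B"
        using openin_topology_join(2)[OF openin_cocompact_topology_compact_open[OF B(1)]]
          compact_open_subset[OF B(1)] X by (simp add: closedin_def topspace_patch_topology)
      ultimately show ?thesis
        using B by blast
    next
      assume "V \<in> {U. openin (cocompact_topology T) U}"
      then have V': "openin (cocompact_topology T) V"
        by simp
      obtain B where B: "compact_open T B" "y \<notin> B" "topspace T - B \<subseteq> V"
        using cocompact_topology_basis[OF coh(2) V' V(2)] .
      have "openin (patch_topology S T) (topspace T - B)"
        using openin_topology_join(2)[OF openin_cocompact_topology_compact_open[OF B(1)]] .
      moreover have "closedin (patch_topology T S) (topspace T - B)"
        using openin_topology_join(1)[of T B] B(1) X
        by (auto simp: closedin_def topspace_patch_topology compact_open_def double_diff openin_subset)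
      moreover have "y \<in> topspace T - B"
        using B(2) V(2) openin_subset[OF V'] by auto
      ultimately show ?thesis
        using B(3) by blast
    qed
    show ?thesis
      using generated_clopen_basis[OF U[unfolded topology_join_def], of "patch_topology T S"] *
      unfolding topology_join_def[of S] by blast
  qed
  then show "openin (patch_topology S T) = arbitrary union_of ?P"
    by (subst openin_topology_base_unique) blast
qed

text \<open>The complement of \<open>B\<close> is closed in the compact topology \<open>J\<close>,
  hence compact there, and compactness passes to the coarser co-compact topology.\<close>

lemma compactin_cocompact_topology_Diff:
  assumes "compact_space J" "topspace J = topspace T" "\<And>U. openin T U \<Longrightarrow> openin J U"
    and fine: "\<And>U. openin (cocompact_topology T) U \<Longrightarrow> openin J U" and B: "compact_open T B"
  shows "compactin (cocompact_topology T) (topspace T - B)"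
proof (rule compactin_coarser[OF _ _ fine])
  have "closedin J (topspace J - B)"
    using assms(3) B by (simp add: compact_open_def closedin_diff)
  then show "compactin J (topspace T - B)"
    using assms(1,2) by (simp add: closedin_compact_space)
qed (use assms(2) in simp)

theorem theorem6p3:
  fixes Tp Tm :: "'a topology"
  assumes "d_spectral Tp Tm"
  shows "d_spectral (cocompact_topology Tp) (cocompact_topology Tm) \<and>
         d_Boolean (topology_join Tp (cocompact_topology Tm))
                   (topology_join Tm (cocompact_topology Tp))"
proof -
  have sp: "bitop_space Tp Tm" "bitop_compact Tp Tm" "d_sober Tp Tm"
    and coh: "coherent_space Tp" "coherent_space Tm"
    using assms by (auto simp: d_spectral_def coherent_frame_opens_order)
  have X: "topspace Tp = topspace Tm"
    using sp by (simp add: bitop_space_def)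
  \<comment> \<open>This compact topology refines both given topologies and both co-compact ones, so
    every compactness claim below is inherited from it.\<close>
  let ?J = "topology_join (patch_topology Tp Tm) (patch_topology Tm Tp)"
  have J: "compact_space ?J" and XJ: "topspace ?J = topspace Tp"
    using bitop_compact_patch[OF sp coh] X
    by (simp_all add: bitop_compact_def topspace_topology_join bitop_space_def topspace_patch_topology)
  have finer: "openin ?J U" if "openin Tp U \<or> openin Tm U \<or>
      openin (cocompact_topology Tp) U \<or> openin (cocompact_topology Tm) U" for U
    using that by (auto intro: openin_topology_join)
  have dual: "coherent_space (cocompact_topology Tp)" "coherent_space (cocompact_topology Tm)"
    using coh X XJ finer
    by (auto intro!: coherent_space_cocompact_topology compactin_cocompact_topology_Diff[OF J])
  have "compactin (topology_join (cocompact_topology Tp) (cocompact_topology Tm)) (topspace Tp)"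
  proof (rule compactin_coarser)
    show "compactin ?J (topspace Tp)"
      using J XJ by (simp add: compact_space_def)
    show "topspace ?J = topspace (topology_join (cocompact_topology Tp) (cocompact_topology Tm))"
      using XJ X by (simp add: topspace_topology_join bitop_space_def)
    show "openin ?J U" if "openin (topology_join (cocompact_topology Tp) (cocompact_topology Tm)) U" for U
      using that by (rule openin_topology_join_least) (use finer in auto)
  qed
  then have "bitop_compact (cocompact_topology Tp) (cocompact_topology Tm)"
    using X by (simp add: bitop_compact_def compact_space_def topspace_topology_join bitop_space_def)
  then have "d_spectral (cocompact_topology Tp) (cocompact_topology Tm)"
    using dual d_sober_cocompact_topology[OF sp coh] X
    by (simp add: d_spectral_def bitop_space_def coherent_frame_opens_order)
  \<comment> \<open>Points that \<open>?J\<close> does not separate lie in the same open sets of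
    both given topologies, so d-sobriety identifies them.\<close>
  moreover have "bitop_t0 (patch_topology Tp Tm) (patch_topology Tm Tp)"
    unfolding bitop_t0_def t0_space_def XJ
  proof (intro ballI impI, rule ccontr)
    fix x y assume xy: "x \<in> topspace Tp" "y \<in> topspace Tp" "x \<noteq> y"
      and "\<nexists>U. openin ?J U \<and> (x \<notin> U) = (y \<in> U)"
    then have "x \<in> U \<longleftrightarrow> y \<in> U" if "openin Tp U \<or> openin Tm U" for U
      using that finer by blast
    then show False
      using d_sober_separates[OF sp(1,3) coh xy(1,2)] xy(3) by (auto simp: compact_open_def)
  qed
  then have "d_Boolean (patch_topology Tp Tm) (patch_topology Tm Tp)"
    using J X patch_topology_clopen_basis[OF X coh] patch_topology_clopen_basis[OF X[symmetric] coh(2,1)]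
    by (simp add: d_Boolean_def bitop_space_def bitop_compact_def bitop_zero_dimensional_def
        topspace_patch_topology)
  ultimately show ?thesis
    by blast
qed

end
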